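(* Let $\mathbf{X}$ be a finite set with $|\mathbf{X}| = N \ge 2$, let $\mathcal{P}^{-\mathbf{X}} = 2^{\mathbf{X}} \setminus \{\varnothing, \mathbf{X}\}$, let $\pi$ be a monotone linkage function on $\mathbf{X}$, and let $M_\pi(\mathbf{T}) = \min_{y \in \mathbf{X}\setminus\mathbf{T}} \pi(y,\mathbf{T})$ for $\mathbf{T} \in \mathcal{P}^{-\mathbf{X}}$. Consider the following algorithm. (1) For every $x \in \mathbf{X}$, greedily form a $\pi$-series $s_\pi(x) = (x_1, x_2, \ldots, x_N)$ with $x_1 = x$ (ties broken arbitrarily), and let $\mathbf{T}_x$ be the smallest starting set $\{x_1,\ldots,x_k\}$, $1 \le k \le N-1$, of this series with $$M_\pi(\mathbf{T}_x) = \max_{1 \le k \le N-1} \pi\bigl(x_{k+1}, \{x_1,\ldots,x_k\}\bigr).$$ (2) Among the distinct inclusion-minimal members of the family $\{\mathbf{T}_x : x \in \mathbf{X}\}$, return those with the largest value of $M_\pi$. Then the collection of sets returned by the algorithm is the collection of all inclusion-minimal maximizers of $M_\pi$ over $\mathcal{P}^{-\mathbf{X}}$.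
   Context: A monotone linkage function on $\mathbf{X}$ is a real-valued function $\pi(y,\mathbf{Z})$, defined for $\mathbf{Z} \in \mathcal{P}^{-\mathbf{X}}$ and $y \in \mathbf{X}\setminus\mathbf{Z}$, such that $\pi(y,\mathbf{S}) \ge \pi(y,\mathbf{T})$ whenever $\mathbf{S} \subseteq \mathbf{T}$ are in $\mathcal{P}^{-\mathbf{X}}$ and $y \in \mathbf{X}\setminus\mathbf{T}$. A $\pi$-series is an ordering $(x_1,\ldots,x_N)$ of all elements of $\mathbf{X}$ such that for every $k = 1,\ldots,N-1$, with starting set $\overline{\mathbf{S}}_k = \{x_1,\ldots,x_k\}$, $$\pi(x_{k+1}, \overline{\mathbf{S}}_k) = \min_{y \in \mathbf{X}\setminus\overline{\mathbf{S}}_k} \pi(y, \overline{\mathbf{S}}_k).$$ In particular $M_\pi(\overline{\mathbf{S}}_k) = \pi(x_{k+1},\overline{\mathbf{S}}_k)$. A maximizer of $M_\pi$ over $\mathcal{P}^{-\mathbf{X}}$ is a set $\mathbf{S}\in\mathcal{P}^{-\mathbf{X}}$ with $M_\pi(\mathbf{S}) = \max_{\mathbf{T} \in \mathcal{P}^{-\mathbf{X}}} M_\pi(\mathbf{T})$; it is inclusion-minimal if no proper subset of it belonging to $\mathcal{P}^{-\mathbf{X}}$ is a maximizer. *)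

theory Defs
  imports Complex_Main
begin

definition proper_subsets :: "'a set \<Rightarrow> 'a set set" where
  "proper_subsets X = Pow X - {{}, X}"

text \<open>A linkage function is a total HOL function \<open>\<pi>\<close>; its values \<open>\<pi> y Z\<close> matter only for
  \<open>Z \<in> proper_subsets X\<close> and \<open>y \<in> X - Z\<close>, and nothing is assumed about the others.\<close>

definition monotone_linkage :: "'a set \<Rightarrow> ('a \<Rightarrow> 'a set \<Rightarrow> real) \<Rightarrow> bool" where
  "monotone_linkage X \<pi> \<longleftrightarrow>
     (\<forall>S \<in> proper_subsets X. \<forall>T \<in> proper_subsets X. \<forall>y \<in> X - T.
        S \<subseteq> T \<longrightarrow> \<pi> y S \<ge> \<pi> y T)"

definition M :: "'a set \<Rightarrow> ('a \<Rightarrow> 'a set \<Rightarrow> real) \<Rightarrow> 'a set \<Rightarrow> real" where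
  "M X \<pi> T = Min ((\<lambda>y. \<pi> y T) ` (X - T))"

text \<open>Lists are indexed from 0, so \<open>x\<^sub>k\<^sub>+\<^sub>1\<close> is \<open>xs ! k\<close>, while \<open>{x\<^sub>1, \<dots>, x\<^sub>k}\<close> is
  \<open>set (take k xs)\<close>.\<close>

definition starting_set :: "'a list \<Rightarrow> nat \<Rightarrow> 'a set" where
  "starting_set xs k = set (take k xs)"

definition pi_series :: "'a set \<Rightarrow> ('a \<Rightarrow> 'a set \<Rightarrow> real) \<Rightarrow> 'a list \<Rightarrow> bool" where
  "pi_series X \<pi> xs \<longleftrightarrow> distinct xs \<and> set xs = X \<and>
     (\<forall>k \<in> {1..card X - 1}.
        \<pi> (xs ! k) (starting_set xs k)
          = Min ((\<lambda>y. \<pi> y (starting_set xs k)) ` (X - starting_set xs k)))"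

text \<open>The starting sets of a series form a strictly increasing chain, so the smallest one with a
  given property is the one of least index.\<close>

definition best_starting_set :: "'a set \<Rightarrow> ('a \<Rightarrow> 'a set \<Rightarrow> real) \<Rightarrow> 'a list \<Rightarrow> 'a set" where
  "best_starting_set X \<pi> xs = starting_set xs
     (LEAST k. k \<in> {1..card X - 1} \<and>
        M X \<pi> (starting_set xs k)
          = Max ((\<lambda>j. \<pi> (xs ! j) (starting_set xs j)) ` {1..card X - 1}))"

definition inclusion_minimal :: "'a set set \<Rightarrow> 'a set set" where
  "inclusion_minimal F = {S \<in> F. \<not> (\<exists>T \<in> F. T \<subset> S)}"

definition maximizers :: "'a set \<Rightarrow> ('a \<Rightarrow> 'a set \<Rightarrow> real) \<Rightarrow> 'a set set" where
  "maximizers X \<pi> =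
     {S \<in> proper_subsets X. M X \<pi> S = Max (M X \<pi> ` proper_subsets X)}"

text \<open>The greedy choices, including the tie-breaking, are recorded in the parameter \<open>s\<close>, which
  assigns to each \<open>x \<in> X\<close> the series formed from \<open>x\<close>.\<close>

definition greedy_choice ::
  "'a set \<Rightarrow> ('a \<Rightarrow> 'a set \<Rightarrow> real) \<Rightarrow> ('a \<Rightarrow> 'a list) \<Rightarrow> bool" where
  "greedy_choice X \<pi> s \<longleftrightarrow> (\<forall>x \<in> X. pi_series X \<pi> (s x) \<and> s x ! 0 = x)"

definition algorithm_output ::
  "'a set \<Rightarrow> ('a \<Rightarrow> 'a set \<Rightarrow> real) \<Rightarrow> ('a \<Rightarrow> 'a list) \<Rightarrow> 'a set set" where
  "algorithm_output X \<pi> s =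
     (let C = inclusion_minimal ((\<lambda>x. best_starting_set X \<pi> (s x)) ` X)
      in {T \<in> C. M X \<pi> T = Max (M X \<pi> ` C)})"

text \<open>Greedy extension never gets stuck, so the algorithm always has a run.\<close>

lemma greedy_prefix_exists:
  assumes "finite X" "x \<in> X" "1 \<le> n" "n \<le> card X"
  shows "\<exists>xs. length xs = n \<and> distinct xs \<and> set xs \<subseteq> X \<and> xs ! 0 = x \<and>
    (\<forall>k \<in> {1..n - 1}. \<pi> (xs ! k) (starting_set xs k)
       = Min ((\<lambda>y. \<pi> y (starting_set xs k)) ` (X - starting_set xs k)))"
  using assms(3,4)
proof (induction n rule: nat_induct_at_least)
  case base
  show ?case by (rule exI[of _ "[x]"]) (use assms in auto)
next
  case (Suc n)
  then obtain xs where xs: "length xs = n" "distinct xs" "set xs \<subseteq> X" "xs ! 0 = x"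
    and opt: "\<And>k. k \<in> {1..n - 1} \<Longrightarrow> \<pi> (xs ! k) (starting_set xs k)
       = Min ((\<lambda>y. \<pi> y (starting_set xs k)) ` (X - starting_set xs k))"
    by auto
  have "card (set xs) < card X"
    using xs Suc.prems by (simp add: distinct_card)
  then have "X - set xs \<noteq> {}"
    using card_mono[of "set xs" X] by fastforce
  then have "Min ((\<lambda>y. \<pi> y (set xs)) ` (X - set xs)) \<in> (\<lambda>y. \<pi> y (set xs)) ` (X - set xs)"
    using assms(1) by (intro Min_in) auto
  then obtain z where z: "z \<in> X - set xs"
    "\<pi> z (set xs) = Min ((\<lambda>y. \<pi> y (set xs)) ` (X - set xs))"
    by auto
  have "\<pi> ((xs @ [z]) ! k) (starting_set (xs @ [z]) k)
      = Min ((\<lambda>y. \<pi> y (starting_set (xs @ [z]) k)) ` (X - starting_set (xs @ [z]) k))"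
    if "k \<in> {1..Suc n - 1}" for k
  proof (cases "k = n")
    case True
    then show ?thesis using z(2) xs(1) by (simp add: starting_set_def nth_append)
  next
    case False
    with that have "k \<in> {1..n - 1}" "k < n" by auto
    with opt[of k] xs(1) show ?thesis by (simp add: starting_set_def nth_append)
  qed
  then show ?case
    using xs z(1) Suc.hyps by (intro exI[of _ "xs @ [z]"]) (auto simp: nth_append)
qed

lemma greedy_choice_exists:
  assumes "finite X"
  shows "\<exists>s. greedy_choice X \<pi> s"
proof -
  have "\<exists>xs. pi_series X \<pi> xs \<and> xs ! 0 = x" if x: "x \<in> X" for x
  proof -
    have "1 \<le> card X"
      using assms x by (metis One_nat_def Suc_leI card_gt_0_iff empty_iff)
    then obtain xs where xs: "length xs = card X" "distinct xs" "set xs \<subseteq> X" "xs ! 0 = x"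
      and opt: "\<forall>k \<in> {1..card X - 1}. \<pi> (xs ! k) (starting_set xs k)
       = Min ((\<lambda>y. \<pi> y (starting_set xs k)) ` (X - starting_set xs k))"
      using greedy_prefix_exists[OF assms x, of "card X" \<pi>] by auto
    have "set xs = X"
      using xs assms by (intro card_subset_eq) (auto simp: distinct_card)
    with xs opt show ?thesis by (auto simp: pi_series_def)
  qed
  then show ?thesis unfolding greedy_choice_def by metis
qed

end

theory Submission
  imports Defs
begin

text \<open>The theorem rests on a comparison between a greedy series and an arbitrary
  \<open>S \<in> proper_subsets X\<close> that contains its first element. Follow the series up to the moment when
  it first leaves \<open>S\<close>, by adding some \<open>y \<notin> S\<close> to a starting set \<open>A \<subseteq> S\<close>. The greedy choice of
  \<open>y\<close> and monotonicity give \<open>M(A) = \<pi>(y, A) \<ge> \<pi>(y, S) \<ge> M(S)\<close>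
  (\<open>starting_set_inside_dominates\<close>).

  In particular, if \<open>S\<close> maximizes \<open>M\<close> and \<open>x \<in> S\<close>, then \<open>A\<close> is a maximizer too. So the best
  value along the series from \<open>x\<close> is the global maximum, and the smallest starting set
  \<open>T\<^sub>x\<close> attaining it is a maximizer inside \<open>A\<close>, hence inside \<open>S\<close>
  (\<open>best_starting_set_refines_maximizer\<close>): every maximizer can be shrunk to some \<open>T\<^sub>x\<close>, starting
  from any of its points.

  The rest is order theory. A minimal maximizer \<open>S\<close> equals \<open>T\<^sub>x\<close> for each \<open>x \<in> S\<close>, and no \<open>T\<^sub>y\<close>
  lies strictly inside it, because \<open>y \<in> T\<^sub>y \<subset> S\<close> would make \<open>T\<^sub>y\<close> a smaller maximizer. So \<open>S\<close> is
  among the minimal members of the family, and the largest value of \<open>M\<close> there is the global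
  maximum. Conversely a maximizer strictly inside a returned set would contain some \<open>T\<^sub>y\<close>,
  contradicting the minimality of the returned set in the family.\<close>

lemma finite_proper_subsets: "finite X \<Longrightarrow> finite (proper_subsets X)"
  by (simp add: proper_subsets_def)

lemma M_le:
  assumes "finite X" "y \<in> X - T"
  shows "M X \<pi> T \<le> \<pi> y T"
  unfolding M_def using assms by (intro Min_le) auto

lemma length_pi_series: "pi_series X \<pi> xs \<Longrightarrow> length xs = card X"
  by (auto simp: pi_series_def distinct_card)

lemma M_starting_set:
  assumes "pi_series X \<pi> xs" "k \<in> {1..card X - 1}"
  shows "M X \<pi> (starting_set xs k) = \<pi> (xs ! k) (starting_set xs k)"
  using assms by (simp add: pi_series_def M_def)

lemma starting_set_mono: "j \<le> k \<Longrightarrow> starting_set xs j \<subseteq> starting_set xs k"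
  by (simp add: starting_set_def set_take_subset_set_take)

lemma starting_set_proper:
  assumes "pi_series X \<pi> xs" "k \<in> {1..card X - 1}"
  shows "starting_set xs k \<in> proper_subsets X" "xs ! 0 \<in> starting_set xs k"
proof -
  have len: "length xs = card X" and xs: "distinct xs" "set xs = X"
    using assms(1) length_pi_series by (auto simp: pi_series_def)
  have "card (starting_set xs k) = k"
    using assms(2) len xs by (auto simp: starting_set_def distinct_card)
  then show "starting_set xs k \<in> proper_subsets X"
    using assms(2) xs set_take_subset[of k xs]
    by (auto simp: proper_subsets_def starting_set_def)
  have "take k xs ! 0 \<in> set (take k xs)"
    using assms(2) len by (intro nth_mem) auto
  then show "xs ! 0 \<in> starting_set xs k"
    using assms(2) by (simp add: starting_set_def)
qed

text \<open>The starting set in question is the last one contained in \<open>S\<close>: the next element of the series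
  lies outside \<open>S\<close>, so its linkage to \<open>S\<close> bounds \<open>M X \<pi> S\<close> from above, and by monotonicity its
  linkage to the starting set is at least as large.\<close>

lemma starting_set_inside_dominates:
  assumes "finite X" "monotone_linkage X \<pi>" "pi_series X \<pi> xs"
    and S: "S \<in> proper_subsets X" "xs ! 0 \<in> S"
  obtains k where "k \<in> {1..card X - 1}" "starting_set xs k \<subseteq> S"
    "M X \<pi> S \<le> M X \<pi> (starting_set xs k)"
proof -
  have len: "length xs = card X" and xs: "set xs = X"
    using assms(3) length_pi_series by (auto simp: pi_series_def)
  obtain i where "i < card X" "xs ! i \<notin> S"
    using S(1) len xs unfolding proper_subsets_def
    by (metis DiffD1 DiffD2 PowD in_set_conv_nth insertCI subsetI subset_antisym)
  define k where "k = (LEAST i. xs ! i \<notin> S)"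
  have out: "xs ! k \<notin> S"
    unfolding k_def using \<open>xs ! i \<notin> S\<close> by (rule LeastI)
  have "k \<le> i"
    unfolding k_def using \<open>xs ! i \<notin> S\<close> by (rule Least_le)
  moreover have "k \<noteq> 0"
    using out S(2) by (intro notI) simp
  ultimately have k: "k \<in> {1..card X - 1}"
    using \<open>i < card X\<close> by auto
  have "xs ! j \<in> S" if "j < k" for j
    using not_less_Least[OF that[unfolded k_def]] by simp
  then have sub: "starting_set xs k \<subseteq> S"
    by (auto simp: starting_set_def in_set_conv_nth)
  have y: "xs ! k \<in> X - S"
    using out k len xs by auto
  then have "M X \<pi> S \<le> \<pi> (xs ! k) S"
    by (rule M_le[OF assms(1)])
  also have "\<dots> \<le> \<pi> (xs ! k) (starting_set xs k)"
    using assms(2) starting_set_proper(1)[OF assms(3) k] S(1) y sub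
    unfolding monotone_linkage_def by blast
  also have "\<dots> = M X \<pi> (starting_set xs k)"
    using M_starting_set[OF assms(3) k] by simp
  finally show thesis
    using that k sub by blast
qed

text \<open>Replacing \<open>\<pi>(x\<^sub>k\<^sub>+\<^sub>1, {x\<^sub>1, \<dots>, x\<^sub>k})\<close> by \<open>M\<close> of the starting set, the best starting set is
  the least element of the chain of starting sets on which \<open>M\<close> is largest.\<close>

lemma best_starting_set:
  assumes "card X \<ge> 2" "pi_series X \<pi> xs"
  shows "\<exists>k \<in> {1..card X - 1}. best_starting_set X \<pi> xs = starting_set xs k"
    and "\<And>j. j \<in> {1..card X - 1} \<Longrightarrow>
      M X \<pi> (starting_set xs j) \<le> M X \<pi> (best_starting_set X \<pi> xs)"
    and "\<And>j. j \<in> {1..card X - 1} \<Longrightarrow>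
      M X \<pi> (starting_set xs j) = M X \<pi> (best_starting_set X \<pi> xs) \<Longrightarrow>
      best_starting_set X \<pi> xs \<subseteq> starting_set xs j"
proof -
  let ?I = "{1..card X - 1}"
  let ?V = "(\<lambda>j. \<pi> (xs ! j) (starting_set xs j)) ` ?I"
  define P where "P k \<longleftrightarrow> k \<in> ?I \<and> M X \<pi> (starting_set xs k) = Max ?V" for k
  have best: "best_starting_set X \<pi> xs = starting_set xs (LEAST k. P k)"
    by (simp add: best_starting_set_def P_def)
  have "Max ?V \<in> ?V"
    using assms(1) by (intro Max_in) auto
  then obtain i where "i \<in> ?I" "Max ?V = \<pi> (xs ! i) (starting_set xs i)"
    by blast
  then have "P i"
    using M_starting_set[OF assms(2)] by (simp add: P_def)
  then have least: "P (LEAST k. P k)"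
    by (rule LeastI)
  then show "\<exists>k \<in> ?I. best_starting_set X \<pi> xs = starting_set xs k"
    by (auto simp: best P_def)
  have val: "M X \<pi> (best_starting_set X \<pi> xs) = Max ?V"
    using least by (simp add: best P_def)
  show "M X \<pi> (starting_set xs j) \<le> M X \<pi> (best_starting_set X \<pi> xs)" if "j \<in> ?I" for j
    unfolding val M_starting_set[OF assms(2) that] using that by (intro Max_ge) auto
  show "best_starting_set X \<pi> xs \<subseteq> starting_set xs j"
    if "j \<in> ?I" "M X \<pi> (starting_set xs j) = M X \<pi> (best_starting_set X \<pi> xs)" for j
    unfolding best using that val
    by (intro starting_set_mono Least_le) (simp add: P_def)
qed

lemma best_starting_set_proper:
  assumes "card X \<ge> 2" "pi_series X \<pi> xs"
  shows "best_starting_set X \<pi> xs \<in> proper_subsets X"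
    and "xs ! 0 \<in> best_starting_set X \<pi> xs"
  using best_starting_set(1)[OF assms] starting_set_proper[OF assms(2)] by auto

lemma maximizers_iff:
  assumes "finite X"
  shows "S \<in> maximizers X \<pi> \<longleftrightarrow>
    S \<in> proper_subsets X \<and> (\<forall>T \<in> proper_subsets X. M X \<pi> T \<le> M X \<pi> S)"
proof -
  have "M X \<pi> S = Max (M X \<pi> ` proper_subsets X) \<longleftrightarrow>
      (\<forall>T \<in> proper_subsets X. M X \<pi> T \<le> M X \<pi> S)" if "S \<in> proper_subsets X"
    using that finite_proper_subsets[OF assms] eq_Max_iff[of "M X \<pi> ` proper_subsets X"]
    by auto
  then show ?thesis
    by (auto simp: maximizers_def)
qed

lemma maximizers_nonempty:
  assumes "finite X" "proper_subsets X \<noteq> {}"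
  shows "maximizers X \<pi> \<noteq> {}"
proof -
  have "Max (M X \<pi> ` proper_subsets X) \<in> M X \<pi> ` proper_subsets X"
    using assms finite_proper_subsets by (intro Max_in) auto
  then show ?thesis
    by (auto simp: maximizers_def)
qed

text \<open>A maximizer \<open>S\<close> containing the first element contains a starting set that is a maximizer as
  well. The best starting set then also has the maximal value, and being the smallest starting set
  with this value it is contained in \<open>S\<close>.\<close>

lemma best_starting_set_refines_maximizer:
  assumes "finite X" "card X \<ge> 2" "monotone_linkage X \<pi>" "pi_series X \<pi> xs"
    and S: "S \<in> maximizers X \<pi>" "xs ! 0 \<in> S"
  shows "best_starting_set X \<pi> xs \<in> maximizers X \<pi>" "best_starting_set X \<pi> xs \<subseteq> S"
proof -
  let ?B = "best_starting_set X \<pi> xs"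
  have S': "S \<in> proper_subsets X" "\<And>T. T \<in> proper_subsets X \<Longrightarrow> M X \<pi> T \<le> M X \<pi> S"
    using S(1) maximizers_iff[OF assms(1)] by auto
  obtain k where k: "k \<in> {1..card X - 1}" "starting_set xs k \<subseteq> S"
    "M X \<pi> S \<le> M X \<pi> (starting_set xs k)"
    using starting_set_inside_dominates[OF assms(1,3,4) S'(1) S(2)] .
  have B: "?B \<in> proper_subsets X"
    by (rule best_starting_set_proper[OF assms(2,4)])
  have "M X \<pi> (starting_set xs k) \<le> M X \<pi> ?B"
    by (rule best_starting_set(2)[OF assms(2,4) k(1)])
  then have eq: "M X \<pi> ?B = M X \<pi> S" "M X \<pi> (starting_set xs k) = M X \<pi> ?B"
    using k(3) S'(2)[OF B] by auto
  show "?B \<in> maximizers X \<pi>"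
    using maximizers_iff[OF assms(1)] B S'(2) eq(1) by auto
  show "?B \<subseteq> S"
    using best_starting_set(3)[OF assms(2,4) k(1) eq(2)] k(2) by blast
qed

lemma inclusion_minimal_below:
  assumes "finite F" "S \<in> F"
  obtains T where "T \<in> inclusion_minimal F" "T \<subseteq> S"
  using finite_has_minimal2[OF assms] unfolding inclusion_minimal_def by blast

theorem theorem5p4:
  fixes X :: "'a set" and \<pi> :: "'a \<Rightarrow> 'a set \<Rightarrow> real" and s :: "'a \<Rightarrow> 'a list"
  assumes "finite X" and "card X \<ge> 2"
    and "monotone_linkage X \<pi>"
    and "greedy_choice X \<pi> s"
  shows "algorithm_output X \<pi> s = inclusion_minimal (maximizers X \<pi>)"
proof -
  define T where "T x = best_starting_set X \<pi> (s x)" for x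
  define C where "C = inclusion_minimal (T ` X)"
  have s: "pi_series X \<pi> (s x)" "s x ! 0 = x" if "x \<in> X" for x
    using assms(4) that by (auto simp: greedy_choice_def)
  have T: "T x \<in> proper_subsets X" "x \<in> T x" if "x \<in> X" for x
    using best_starting_set_proper[OF assms(2) s(1)[OF that]] s(2)[OF that]
    by (auto simp: T_def)
  have refines: "T x \<in> maximizers X \<pi>" "T x \<subseteq> S" if "S \<in> maximizers X \<pi>" "x \<in> S" for S x
  proof -
    have "x \<in> X"
      using that by (auto simp: maximizers_def proper_subsets_def)
    then show "T x \<in> maximizers X \<pi>" "T x \<subseteq> S"
      using best_starting_set_refines_maximizer[OF assms(1-3) s(1) that(1)] s(2) that(2)
      by (auto simp: T_def)
  qed
  have pts: "\<exists>x. x \<in> X \<and> x \<in> S" if "S \<in> maximizers X \<pi>" for S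
    using that by (auto simp: maximizers_def proper_subsets_def)
  have C_proper: "C \<subseteq> proper_subsets X"
    using T(1) by (auto simp: C_def inclusion_minimal_def)
  then have "finite C"
    using finite_proper_subsets[OF assms(1)] finite_subset by blast
  have min_in_C: "S \<in> C" if "S \<in> inclusion_minimal (maximizers X \<pi>)" for S
  proof -
    have S: "S \<in> maximizers X \<pi>" "\<And>R. R \<in> maximizers X \<pi> \<Longrightarrow> \<not> R \<subset> S"
      using that by (auto simp: inclusion_minimal_def)
    obtain x where "x \<in> X" "x \<in> S"
      using pts[OF S(1)] by blast
    then have "S = T x"
      using refines[OF S(1)] S(2) by blast
    moreover have "\<not> T y \<subset> S" if "y \<in> X" for y
      using refines(1)[OF S(1), of y] S(2) T(2)[OF that] by blast
    ultimately show ?thesis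
      using \<open>x \<in> X\<close> by (auto simp: C_def inclusion_minimal_def)
  qed
  have "proper_subsets X \<noteq> {}"
    using T(1) assms(2) by (cases "X = {}") auto
  then obtain S\<^sub>0 where "S\<^sub>0 \<in> maximizers X \<pi>"
    using maximizers_nonempty[OF assms(1)] by blast
  moreover have "finite (maximizers X \<pi>)"
    using finite_proper_subsets[OF assms(1)] by (simp add: maximizers_def)
  ultimately obtain S\<^sub>1 where S\<^sub>1: "S\<^sub>1 \<in> inclusion_minimal (maximizers X \<pi>)"
    using inclusion_minimal_below by blast
  then have S\<^sub>1_max: "S\<^sub>1 \<in> maximizers X \<pi>"
    by (simp add: inclusion_minimal_def)
  have "Max (M X \<pi> ` C) = M X \<pi> S\<^sub>1"
    using \<open>finite C\<close> min_in_C[OF S\<^sub>1] C_proper S\<^sub>1_max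
    by (intro Max_eqI) (auto simp: maximizers_iff[OF assms(1)])
  also have "\<dots> = Max (M X \<pi> ` proper_subsets X)"
    using S\<^sub>1_max by (simp add: maximizers_def)
  finally have max_C: "Max (M X \<pi> ` C) = Max (M X \<pi> ` proper_subsets X)" .
  have "algorithm_output X \<pi> s = {R \<in> C. M X \<pi> R = Max (M X \<pi> ` C)}"
    unfolding algorithm_output_def C_def T_def Let_def ..
  then have result: "algorithm_output X \<pi> s = C \<inter> maximizers X \<pi>"
    using C_proper unfolding max_C maximizers_def by blast
  show ?thesis
  proof
    show "inclusion_minimal (maximizers X \<pi>) \<subseteq> algorithm_output X \<pi> s"
      using min_in_C unfolding result by (auto simp: inclusion_minimal_def)
    have "\<not> S \<subset> R" if "R \<in> C" "S \<in> maximizers X \<pi>" for R S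
    proof
      assume "S \<subset> R"
      obtain y where "y \<in> X" "y \<in> S"
        using pts[OF \<open>S \<in> maximizers X \<pi>\<close>] by blast
      then have "T y \<subset> R"
        using refines(2)[OF that(2)] \<open>S \<subset> R\<close> by blast
      then show False
        using \<open>R \<in> C\<close> \<open>y \<in> X\<close> by (auto simp: C_def inclusion_minimal_def)
    qed
    then show "algorithm_output X \<pi> s \<subseteq> inclusion_minimal (maximizers X \<pi>)"
      unfolding result by (auto simp: inclusion_minimal_def)
  qed
qed

end
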